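(* Let $k\ge 1$ and let $H_1,\ldots,H_k$ be non-bipartite graphs, and let $r^*:=r^*(H_1,\ldots,H_k)$. For every $\varepsilon>0$ there is $n_0$ such that for all $n\ge n_0$, $$\mathrm{nim}(n;H_1,\ldots,H_k)\le \left(1-\frac{1}{r^*}\right)\frac{n^2}{2}+\varepsilon n^2.$$ Furthermore, if each $H_i$ is connected, or if there exists a feasible colouring $\xi:\binom{[r^*]}{\le 2}\to[k]$ (with respect to $(H_1,\ldots,H_k)$) that assigns the same colour to all singletons, then $\mathrm{nim}(n;H_1,\ldots,H_k)\ge t(n,r^* )$.
   Context: For a $k$-edge-colouring $\phi$ of $K_n$, an edge is a NIM-edge if for no $i\in[k]$ it is contained in a copy of $H_i$ all of whose edges have colour $i$; $\mathrm{nim}(\phi;H_1,\ldots,H_k)$ is the number of NIM-edges, and $\mathrm{nim}(n;H_1,\ldots,H_k)$ is the maximum of this over all $k$-edge-colourings of $K_n$. A homomorphism $H\to G$ is a (not necessarily injective) map $V(H)\to V(G)$ sending edges to edges. For a set $X$, $\binom{X}{\le 2}$ is the set of subsets of $X$ of size at most 2. A colouring $\xi:\binom{[r]}{\le 2}\to[k]$ is feasible (with respect to $(H_1,\ldots,H_k)$) if (P1) for each $i\in[k]$ there is no homomorphism from $H_i$ to the graph on $[r]$ whose edges are the pairs $\{a,b\}$ with $\xi(\{a,b\})=i$, and (P2) for all distinct $a,b\in[r]$, $\xi(\{a,b\})\ne\xi(\{a\})$. Then $r^*(H_1,\ldots,H_k)$ is the maximum $r$ for which a feasible colouring of $\binom{[r]}{\le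 2}$ exists. $T(n,r)$ is the Turán graph (complete balanced $r$-partite graph on $n$ vertices) and $t(n,r)=e(T(n,r))$. *)

theory Defs
  imports Complex_Main "HOL-Library.FuncSet" "HOL-Library.Ramsey"
begin

text \<open>A graph is a pair of a vertex set and an edge set, the edges being 2-element vertex sets;
  \<open>nsets A 2\<close> is the set of all 2-element subsets of \<open>A\<close>.\<close>

type_synonym 'a graph = "'a set \<times> 'a set set"

abbreviation verts :: "'a graph \<Rightarrow> 'a set" where
  "verts G \<equiv> fst G"

abbreviation edges :: "'a graph \<Rightarrow> 'a set set" where
  "edges G \<equiv> snd G"

definition fin_simple_graph :: "'a graph \<Rightarrow> bool" where
  "fin_simple_graph G \<longleftrightarrow> finite (verts G) \<and> edges G \<subseteq> nsets (verts G) 2"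

definition bipartite :: "'a graph \<Rightarrow> bool" where
  "bipartite G \<longleftrightarrow> (\<exists>X Y. X \<union> Y = verts G \<and> X \<inter> Y = {} \<and>
     (\<forall>e\<in>edges G. e \<inter> X \<noteq> {} \<and> e \<inter> Y \<noteq> {}))"

definition graph_connected :: "'a graph \<Rightarrow> bool" where
  "graph_connected G \<longleftrightarrow> verts G \<noteq> {} \<and>
     (\<forall>u\<in>verts G. \<forall>v\<in>verts G. (u, v) \<in> {(x, y). {x, y} \<in> edges G}\<^sup>*)"

definition graph_hom :: "('a \<Rightarrow> 'b) \<Rightarrow> 'a graph \<Rightarrow> 'b graph \<Rightarrow> bool" where
  "graph_hom f G G' \<longleftrightarrow> f \<in> verts G \<rightarrow> verts G' \<and> (\<forall>e\<in>edges G. f ` e \<in> edges G')"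

definition graph_iso :: "('a \<Rightarrow> 'b) \<Rightarrow> 'a graph \<Rightarrow> 'b graph \<Rightarrow> bool" where
  "graph_iso f G G' \<longleftrightarrow> bij_betw f (verts G) (verts G') \<and> edges G' = (\<lambda>e. f ` e) ` edges G"

definition subgraph :: "'a graph \<Rightarrow> 'a graph \<Rightarrow> bool" where
  "subgraph F G \<longleftrightarrow> verts F \<subseteq> verts G \<and> edges F \<subseteq> edges G"

definition is_copy_in :: "'b graph \<Rightarrow> 'a graph \<Rightarrow> 'b graph \<Rightarrow> bool" where
  "is_copy_in F H G \<longleftrightarrow> subgraph F G \<and> (\<exists>f. graph_iso f H F)"

definition complete_graph :: "nat \<Rightarrow> nat graph" where
  "complete_graph n = ({1..n}, nsets {1..n} 2)"

text \<open>Throughout, the colours are \<open>1, \<dots>, k\<close> and the forbidden graphs \<open>H 1, \<dots>, H k\<close>. A colouring is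
  a total function on sets of vertices, of which only the values on the objects being coloured
  matter.\<close>

definition edge_colouring :: "nat \<Rightarrow> nat \<Rightarrow> (nat set \<Rightarrow> nat) \<Rightarrow> bool" where
  "edge_colouring k n \<phi> \<longleftrightarrow> \<phi> \<in> edges (complete_graph n) \<rightarrow> {1..k}"

definition nim_edges :: "nat \<Rightarrow> (nat \<Rightarrow> 'a graph) \<Rightarrow> nat \<Rightarrow> (nat set \<Rightarrow> nat) \<Rightarrow> nat set set" where
  "nim_edges k H n \<phi> = {e \<in> edges (complete_graph n).
     \<not> (\<exists>i\<in>{1..k}. \<exists>F. is_copy_in F (H i) (complete_graph n) \<and>
          e \<in> edges F \<and> (\<forall>e'\<in>edges F. \<phi> e' = i))}"

text \<open>The maximum is over a set of numbers bounded by the number of edges of the complete graph,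
  and nonempty as soon as \<open>k \<ge> 1\<close>.\<close>

definition nim :: "nat \<Rightarrow> (nat \<Rightarrow> 'a graph) \<Rightarrow> nat \<Rightarrow> nat" where
  "nim k H n = Max {card (nim_edges k H n \<phi>) | \<phi>. edge_colouring k n \<phi>}"

definition colour_graph :: "nat \<Rightarrow> (nat set \<Rightarrow> nat) \<Rightarrow> nat \<Rightarrow> nat graph" where
  "colour_graph r \<xi> i = ({1..r}, {e \<in> nsets {1..r} 2. \<xi> e = i})"

definition feasible :: "nat \<Rightarrow> (nat \<Rightarrow> 'a graph) \<Rightarrow> nat \<Rightarrow> (nat set \<Rightarrow> nat) \<Rightarrow> bool" where
  "feasible k H r \<xi> \<longleftrightarrow>
     \<xi> \<in> {S. S \<subseteq> {1..r} \<and> card S \<le> 2} \<rightarrow> {1..k} \<and>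
     (\<forall>i\<in>{1..k}. \<not> (\<exists>f. graph_hom f (H i) (colour_graph r \<xi> i))) \<and>
     (\<forall>a\<in>{1..r}. \<forall>b\<in>{1..r}. a \<noteq> b \<longrightarrow> \<xi> {a, b} \<noteq> \<xi> {a})"

text \<open>If \<open>k \<ge> 1\<close> and the graphs are finite and non-bipartite, the set below contains 1 (a single
  vertex spans no edge) and is finite by Ramsey's theorem (a monochromatic clique on
  \<open>|V(H i)|\<close> vertices receives a homomorphism from \<open>H i\<close>).\<close>

definition r_star :: "nat \<Rightarrow> (nat \<Rightarrow> 'a graph) \<Rightarrow> nat" where
  "r_star k H = Max {r. \<exists>\<xi>. feasible k H r \<xi>}"

text \<open>The parts are the residue classes modulo \<open>r\<close> (for \<open>r \<ge> 1\<close>), whose sizes differ by at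
  most one.\<close>

definition turan_graph :: "nat \<Rightarrow> nat \<Rightarrow> nat graph" where
  "turan_graph n r = ({1..n}, {{x, y} | x y. x \<in> {1..n} \<and> y \<in> {1..n} \<and> x mod r \<noteq> y mod r})"

definition turan_number :: "nat \<Rightarrow> nat \<Rightarrow> nat" where
  "turan_number n r = card (edges (turan_graph n r))"

end

theory Submission
  imports Defs
begin

text \<open>Upper bound: if the graph of NIM-edges has density above \<open>1 - 1 / r\<^sup>*\<close>, then by Erdos--Stone it
  contains a complete \<open>(r\<^sup>* + 1)\<close>-partite graph with huge parts. All edges of the complete graph
  are coloured, so Ramsey's theorem shrinks the parts until each part and each pair of parts is
  monochromatic. These colours form a feasible colouring on \<open>r\<^sup>* + 1\<close> points, a contradiction: a
  homomorphism violating (P1) lifts to a monochromatic copy through NIM-edges, and if a pair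
  \<open>{a, b}\<close> has the colour of \<open>{a}\<close>, then embedding one vertex of \<open>H\<^sub>i\<close> into part \<open>b\<close> and
  all others into part \<open>a\<close> gives such a copy. Szemeredi's regularity lemma is not needed.

  Lower bound: pull a feasible colouring back along the partition of the Turan graph. A
  monochromatic copy through a Turan edge that uses no edge inside a part projects to a
  homomorphism excluded by (P1).\<close>

section \<open>The Erdos--Stone theorem\<close>

text \<open>Parts are indexed by \<open>{1..r}\<close>, and \<open>b i x\<close> for \<open>x < t\<close> lists the vertices of part \<open>i\<close>. If
  \<open>E\<close> has no loops, then distinct parts are automatically disjoint.\<close>

definition complete_multipartite ::
  "nat \<Rightarrow> nat \<Rightarrow> 'v set \<Rightarrow> 'v set set \<Rightarrow> (nat \<Rightarrow> nat \<Rightarrow> 'v) \<Rightarrow> bool" where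
  "complete_multipartite r t V E b \<longleftrightarrow>
     (\<forall>i\<in>{1..r}. b i \<in> {..<t} \<rightarrow> V \<and> inj_on (b i) {..<t}) \<and>
     (\<forall>i\<in>{1..r}. \<forall>j\<in>{1..r}. i \<noteq> j \<longrightarrow> (\<forall>x<t. \<forall>y<t. {b i x, b j y} \<in> E))"

lemma inj_from_lessThan:
  assumes "finite A" "t \<le> card A"
  obtains h :: "nat \<Rightarrow> 'b" where "h \<in> {..<t} \<rightarrow> A" "inj_on h {..<t}"
proof -
  obtain h where "inj_on h {..<t}" "h ` {..<t} \<subseteq> A"
    using card_le_inj[of "{..<t}" A] assms by auto
  then show thesis
    by (intro that[of h]) auto
qed

lemma pigeonhole_card_fibre:
  assumes "finite R" "f \<in> W \<rightarrow> R" "card R * t < card W"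
  shows "\<exists>y\<in>R. t \<le> card {w \<in> W. f w = y}"
proof (rule ccontr)
  assume "\<not> ?thesis"
  then have small: "card {w \<in> W. f w = y} \<le> t" if "y \<in> R" for y
    using that nat_le_linear by blast
  have "W = (\<Union>y\<in>R. {w \<in> W. f w = y})"
    using assms(2) by auto
  then have "card W \<le> (\<Sum>y\<in>R. card {w \<in> W. f w = y})"
    using card_UN_le[OF assms(1)] by metis
  also have "\<dots> \<le> card R * t"
    using sum_bounded_above[of R "\<lambda>y. card {w \<in> W. f w = y}" t] small by simp
  finally show False
    using assms(3) by simp
qed

text \<open>Double counting of non-adjacent pairs of a vertex \<open>w\<close> and an index
  \<open>(i, x)\<close>. A vertex outside the counted set misses at least \<open>T - t\<close>
  vertices of some part, whereas each of the \<open>r * T\<close> indices contributes at most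
  \<open>(1 - \<delta>) * card V / r\<close> non-neighbours.\<close>

lemma many_common_neighbours:
  fixes \<delta> :: real and b :: "nat \<Rightarrow> nat \<Rightarrow> 'v"
  assumes fin: "finite V" and \<delta>: "0 < \<delta>" "\<delta> \<le> 1"
    and b: "\<And>i x. i \<in> {1..r} \<Longrightarrow> x < T \<Longrightarrow> b i x \<in> V"
    and deg: "\<And>v. v \<in> V \<Longrightarrow> real r * real (card {u \<in> V. {v, u} \<notin> E}) \<le> (1 - \<delta>) * real (card V)"
    and T: "real t \<le> \<delta> / 2 * real T" "0 < T"
  shows "\<delta> / 2 * real (card V) \<le> real (card {w \<in> V. \<forall>i\<in>{1..r}. t \<le> card {x \<in> {..<T}. {b i x, w} \<in> E}})"
    (is "_ \<le> real (card ?W)")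
proof -
  let ?I = "{1..r} \<times> {..<T}"
  define bad where "bad w = {(i, x) \<in> ?I. {b i x, w} \<notin> E}" for w
  have "T - t \<le> card (bad w)" if w: "w \<in> V - ?W" for w
  proof -
    obtain i where i: "i \<in> {1..r}" "card {x \<in> {..<T}. {b i x, w} \<in> E} < t"
      using w by auto
    let ?A = "{x \<in> {..<T}. {b i x, w} \<in> E}"
    have "T - t \<le> card ({..<T} - ?A)"
      using i(2) by (subst card_Diff_subset) auto
    also have "\<dots> = card (Pair i ` ({..<T} - ?A))"
      by (rule card_image[symmetric]) (simp add: inj_on_def)
    also have "\<dots> \<le> card (bad w)"
      using i(1) by (intro card_mono finite_subset[of "bad w" ?I]) (auto simp: bad_def)
    finally show ?thesis .
  qed
  then have "card (V - ?W) * (T - t) \<le> (\<Sum>w\<in>V - ?W. card (bad w))"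
    using sum_bounded_below[of "V - ?W" "T - t" "\<lambda>w. card (bad w)"] by simp
  also have "\<dots> \<le> (\<Sum>w\<in>V. card (bad w))"
    using fin by (intro sum_mono2) auto
  also have "\<dots> = (\<Sum>w\<in>V. \<Sum>p\<in>?I. of_bool ({b (fst p) (snd p), w} \<notin> E))"
    by (intro sum.cong refl) (auto simp: bad_def Int_def intro!: arg_cong[of _ _ card])
  also have "\<dots> = (\<Sum>p\<in>?I. \<Sum>w\<in>V. of_bool ({b (fst p) (snd p), w} \<notin> E))"
    by (rule sum.swap)
  also have "\<dots> = (\<Sum>p\<in>?I. card {w \<in> V. {b (fst p) (snd p), w} \<notin> E})"
    using fin by (simp add: Int_def)
  finally have "real (card (V - ?W) * (T - t)) \<le> (\<Sum>p\<in>?I. real (card {w \<in> V. {b (fst p) (snd p), w} \<notin> E}))"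
    unfolding of_nat_sum[symmetric] of_nat_le_iff .
  also have "\<dots> \<le> (\<Sum>p\<in>?I. (1 - \<delta>) * real (card V) / real r)"
  proof (rule sum_mono)
    fix p assume p: "p \<in> ?I"
    then have "b (fst p) (snd p) \<in> V"
      by (intro b) auto
    from deg[OF this] p show "real (card {w \<in> V. {b (fst p) (snd p), w} \<notin> E}) \<le> (1 - \<delta>) * real (card V) / real r"
      by (auto simp: pos_le_divide_eq mult.commute)
  qed
  \<comment> \<open>For \<open>r = 0\<close> the sum is empty; otherwise the factor \<open>r\<close>
    in the number of indices cancels the denominator.\<close>
  also have "\<dots> \<le> real T * ((1 - \<delta>) * real (card V))"
    using \<delta> by (cases "r = 0") (simp_all add: mult_nonneg_nonneg)
  finally have 1: "real (card (V - ?W)) * real (T - t) \<le> real T * ((1 - \<delta>) * real (card V))"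
    by simp
  have "(1 - \<delta> / 2) * real T \<le> real (T - t)"
  proof -
    have "real T - real t \<le> real (T - t)"
      by linarith
    then show ?thesis
      using T by (simp add: algebra_simps)
  qed
  from mult_left_mono[OF this, of "real (card (V - ?W))"] 1
  have "real T * (real (card (V - ?W)) * (1 - \<delta> / 2)) \<le> real T * ((1 - \<delta>) * real (card V))"
    by (simp add: algebra_simps)
  then have "real (card (V - ?W)) * (1 - \<delta> / 2) \<le> (1 - \<delta>) * real (card V)"
    using T(2) by simp
  \<comment> \<open>Completing the square produces a second factor \<open>1 - \<delta> / 2\<close>;
    one of the two then cancels, being positive.\<close>
  also have "\<dots> \<le> (1 - \<delta> / 2) * (1 - \<delta> / 2) * real (card V)"
  proof (rule mult_right_mono)
    have "(1 - \<delta> / 2) * (1 - \<delta> / 2) = 1 - \<delta> + (\<delta> / 2)\<^sup>2"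
      by (simp add: algebra_simps power2_eq_square)
    then show "1 - \<delta> \<le> (1 - \<delta> / 2) * (1 - \<delta> / 2)"
      by simp
  qed simp
  finally have "(1 - \<delta> / 2) * real (card (V - ?W)) \<le> (1 - \<delta> / 2) * ((1 - \<delta> / 2) * real (card V))"
    by (simp add: mult_ac)
  then have "real (card (V - ?W)) \<le> (1 - \<delta> / 2) * real (card V)"
    using \<delta> by simp
  moreover have "card V = card ?W + card (V - ?W)"
    using fin card_mono[OF fin, of ?W] by (subst card_Diff_subset) auto
  ultimately show ?thesis
    by (simp add: algebra_simps)
qed

text \<open>Stating the degree condition through non-neighbours and with a factor \<open>r\<close> instead of a
  denominator makes it vacuous for \<open>r = 0\<close> and lets the same \<open>\<delta>\<close> serve throughout the induction.\<close>

lemma complete_multipartite_of_min_degree: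
  fixes \<delta> :: real
  assumes \<delta>: "0 < \<delta>" "\<delta> \<le> 1"
  shows "\<exists>n0. \<forall>(V :: 'v set) E. finite V \<and> n0 \<le> card V \<and>
           (\<forall>v\<in>V. real r * real (card {u \<in> V. {v, u} \<notin> E}) \<le> (1 - \<delta>) * real (card V))
         \<longrightarrow> (\<exists>b. complete_multipartite (Suc r) t V E b)"
proof (induction r arbitrary: t)
  case 0
  show ?case
  proof (intro exI[of _ t] allI impI, elim conjE)
    fix V :: "'v set" and E
    assume V: "finite V" "t \<le> card V"
    then obtain h where "h \<in> {..<t} \<rightarrow> V" "inj_on h {..<t}"
      by (rule inj_from_lessThan)
    then show "\<exists>b. complete_multipartite (Suc 0) t V E b"
      by (intro exI[of _ "\<lambda>_. h"]) (auto simp: complete_multipartite_def)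
  qed
next
  case (Suc r)
  \<comment> \<open>The old parts must be long enough that a \<open>\<delta> / 2\<close> fraction of
    each still contains \<open>t\<close> vertices.\<close>
  define T where "T = Suc (nat \<lceil>2 * real t / \<delta>\<rceil>)"
  have "2 * real t / \<delta> \<le> real T"
    unfolding T_def by linarith
  then have T: "real t \<le> \<delta> / 2 * real T" "0 < T"
    using \<delta> by (auto simp: T_def field_simps)
  from Suc.IH[of T] obtain n1 where n1: "\<forall>(V :: 'v set) E. finite V \<and> n1 \<le> card V \<and>
      (\<forall>v\<in>V. real r * real (card {u \<in> V. {v, u} \<notin> E}) \<le> (1 - \<delta>) * real (card V))
      \<longrightarrow> (\<exists>b. complete_multipartite (Suc r) T V E b)" ..
  \<comment> \<open>Candidates for the new part are sorted by their neighbourhoods in the old parts.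
    The number of such traces is independent of \<open>V\<close>, so in a large graph
    \<open>t\<close> candidates share one.\<close>
  define R where "R = {1..Suc r} \<rightarrow>\<^sub>E Pow {..<T}"
  have finR: "finite R"
    unfolding R_def by (intro finite_PiE) auto
  \<comment> \<open>\<open>Suc\<close> makes \<open>\<delta> / 2 * card V\<close> strictly larger
    than \<open>card R * t\<close>, as the pigeonhole principle requires.\<close>
  define n2 where "n2 = Suc (nat \<lceil>2 * real (card R * t) / \<delta>\<rceil>)"
  show ?case
  proof (intro exI[of _ "max n1 n2"] allI impI, elim conjE)
    fix V :: "'v set" and E
    assume fin: "finite V" and card: "max n1 n2 \<le> card V"
      and deg: "\<forall>v\<in>V. real (Suc r) * real (card {u \<in> V. {v, u} \<notin> E}) \<le> (1 - \<delta>) * real (card V)"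
    have "\<exists>b. complete_multipartite (Suc r) T V E b"
    proof (rule n1[rule_format], intro conjI ballI)
      fix v assume "v \<in> V"
      then have "real (Suc r) * real (card {u \<in> V. {v, u} \<notin> E}) \<le> (1 - \<delta>) * real (card V)"
        using deg by blast
      then show "real r * real (card {u \<in> V. {v, u} \<notin> E}) \<le> (1 - \<delta>) * real (card V)"
        by (simp add: algebra_simps)
    qed (use fin card in auto)
    then obtain b where b: "complete_multipartite (Suc r) T V E b"
      by blast
    define W where "W = {w \<in> V. \<forall>i\<in>{1..Suc r}. t \<le> card {x \<in> {..<T}. {b i x, w} \<in> E}}"
    have "\<delta> / 2 * real (card V) \<le> real (card W)"
      unfolding W_def using b deg
      by (intro many_common_neighbours[OF fin \<delta> _ _ T]) (auto simp: complete_multipartite_def Pi_iff)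
    moreover have "2 * real (card R * t) / \<delta> < real (card V)"
      using card unfolding n2_def by linarith
    ultimately have "real (card R * t) < real (card W)"
      using \<delta> by (simp add: field_simps)
    then have cardW: "card R * t < card W"
      by (simp only: of_nat_less_iff)
    define f where "f w = (\<lambda>i\<in>{1..Suc r}. {x \<in> {..<T}. {b i x, w} \<in> E})" for w
    have "f \<in> W \<rightarrow> R"
      unfolding f_def R_def by (intro funcsetI restrict_PiE_iff[THEN iffD2]) auto
    from pigeonhole_card_fibre[OF finR this cardW]
    obtain S where S: "S \<in> R" "t \<le> card {w \<in> W. f w = S}" ..
    have "finite {w \<in> W. f w = S}"
      using fin by (simp add: W_def)
    then obtain g where g: "g \<in> {..<t} \<rightarrow> {w \<in> W. f w = S}" "inj_on g {..<t}"
      using S(2) by (rule inj_from_lessThan)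
    have gS: "S i = {x \<in> {..<T}. {b i x, g y} \<in> E} \<and> t \<le> card (S i)"
      if "i \<in> {1..Suc r}" "y < t" for i y
    proof -
      have "g y \<in> W" "S = f (g y)"
        using g(1) that(2) by auto
      then have "S i = {x \<in> {..<T}. {b i x, g y} \<in> E}" "t \<le> card {x \<in> {..<T}. {b i x, g y} \<in> E}"
        using that(1) unfolding f_def W_def by simp_all
      then show ?thesis
        by simp
    qed
    \<comment> \<open>The size of \<open>S i\<close> is read off from \<open>g 0\<close>, which is a
      candidate only if \<open>t > 0\<close>; for \<open>t = 0\<close> any map will do.\<close>
    have "\<exists>h. h \<in> {..<t} \<rightarrow> S i \<and> inj_on h {..<t}" if i: "i \<in> {1..Suc r}" for i
    proof (cases "t = 0")
      case False
      then have Si: "S i = {x \<in> {..<T}. {b i x, g 0} \<in> E}" and cardS: "t \<le> card (S i)"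
        using gS[OF i, of 0] by blast+
      have "finite (S i)"
        unfolding Si by simp
      from inj_from_lessThan[OF this cardS] show ?thesis
        by blast
    qed simp
    then have "\<forall>i\<in>{1..Suc r}. \<exists>h. h \<in> {..<t} \<rightarrow> S i \<and> inj_on h {..<t}"
      by blast
    from bchoice[OF this] obtain h where h: "h i \<in> {..<t} \<rightarrow> S i" "inj_on (h i) {..<t}"
      if "i \<in> {1..Suc r}" for i
      by blast
    have hT: "h i x < T" and hE: "{b i (h i x), g y} \<in> E"
      if "i \<in> {1..Suc r}" "x < t" "y < t" for i x y
    proof -
      have "h i x \<in> S i"
        using h(1)[OF that(1)] that(2) by (simp add: Pi_iff)
      then have "h i x \<in> {x \<in> {..<T}. {b i x, g y} \<in> E}"
        using gS[OF that(1,3)] by (simp only:)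
      then show "h i x < T" "{b i (h i x), g y} \<in> E"
        by simp_all
    qed
    \<comment> \<open>The old parts are thinned to the common trace \<open>S\<close>, all of whose
      vertices are joined to all \<open>g y\<close>; the new part gets the last index.\<close>
    define b' where "b' i x = (if i = Suc (Suc r) then g x else b i (h i x))" for i x
    have "complete_multipartite (Suc (Suc r)) t V E b'"
      unfolding complete_multipartite_def
    proof (intro conjI ballI impI allI)
      fix i assume i: "i \<in> {1..Suc (Suc r)}"
      show "b' i \<in> {..<t} \<rightarrow> V"
        using i g(1) hT b by (auto simp: b'_def W_def complete_multipartite_def Pi_iff)
      show "inj_on (b' i) {..<t}"
      proof (cases "i = Suc (Suc r)")
        case True
        then show ?thesis
          using g(2) by (simp add: b'_def inj_on_def)
      next
        case False
        then have i': "i \<in> {1..Suc r}"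
          using i by auto
        then have "inj_on (b i) {..<T}"
          using b by (auto simp: complete_multipartite_def)
        then show ?thesis
          using False hT[OF i'] h(2)[OF i'] by (auto simp: b'_def inj_on_def)
      qed
    next
      fix i j x y
      assume ij: "i \<in> {1..Suc (Suc r)}" "j \<in> {1..Suc (Suc r)}" "i \<noteq> j" and xy: "x < t" "y < t"
      consider "i = Suc (Suc r)" "j \<in> {1..Suc r}" | "j = Suc (Suc r)" "i \<in> {1..Suc r}"
        | "i \<in> {1..Suc r}" "j \<in> {1..Suc r}"
        using ij by force
      then show "{b' i x, b' j y} \<in> E"
      proof cases
        case 1
        then show ?thesis
          using hE[of j y x] xy by (auto simp: b'_def insert_commute)
      next
        case 2
        then show ?thesis
          using hE[of i x y] xy by (auto simp: b'_def)
      next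
        case 3
        then show ?thesis
          using b hT[OF 3(1), of x x] hT[OF 3(2), of y y] xy ij(3)
          by (auto simp: b'_def complete_multipartite_def)
      qed
    qed
    then show "\<exists>b. complete_multipartite (Suc (Suc r)) t V E b"
      by blast
  qed
qed

section \<open>From edge density to minimum degree\<close>

lemma card_edges_le_square:
  assumes "finite V" "\<And>e. e \<in> E \<Longrightarrow> card e = 2"
  shows "card {e \<in> E. e \<subseteq> V} \<le> (card V)\<^sup>2"
proof -
  have "{e \<in> E. e \<subseteq> V} \<subseteq> (\<lambda>(u, v). {u, v}) ` (V \<times> V)"
    using assms(2) by (force simp: card_2_iff)
  then have "card {e \<in> E. e \<subseteq> V} \<le> card (V \<times> V)"
    using assms(1) by (intro surj_card_le) auto
  then show ?thesis
    by (simp add: card_cartesian_product power2_eq_square)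
qed

lemma card_edges_remove_vertex:
  assumes "finite V" "v \<in> V" "\<And>e. e \<in> E \<Longrightarrow> card e = 2"
  shows "card {e \<in> E. e \<subseteq> V} \<le> card {e \<in> E. e \<subseteq> V - {v}} + card {u \<in> V. {v, u} \<in> E}"
proof -
  have "{e \<in> E. e \<subseteq> V} \<subseteq> {e \<in> E. e \<subseteq> V - {v}} \<union> (\<lambda>u. {v, u}) ` {u \<in> V. {v, u} \<in> E}"
  proof
    fix e assume e: "e \<in> {e \<in> E. e \<subseteq> V}"
    then obtain x y where "e = {x, y}"
      using assms(3) by (metis (lifting) card_2_iff mem_Collect_eq)
    then show "e \<in> {e \<in> E. e \<subseteq> V - {v}} \<union> (\<lambda>u. {v, u}) ` {u \<in> V. {v, u} \<in> E}"
      using e by (cases "v = x"; cases "v = y") (auto simp: insert_commute)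
  qed
  then have "card {e \<in> E. e \<subseteq> V} \<le>
      card ({e \<in> E. e \<subseteq> V - {v}} \<union> (\<lambda>u. {v, u}) ` {u \<in> V. {v, u} \<in> E})"
    using assms(1) by (intro card_mono finite_UnI finite_imageI) (auto intro: finite_subset[of _ "Pow V"])
  also have "\<dots> \<le> card {e \<in> E. e \<subseteq> V - {v}} + card ((\<lambda>u. {v, u}) ` {u \<in> V. {v, u} \<in> E})"
    by (rule card_Un_le)
  also have "card ((\<lambda>u. {v, u}) ` {u \<in> V. {v, u} \<in> E}) \<le> card {u \<in> V. {v, u} \<in> E}"
    using assms(1) by (intro card_image_le) auto
  finally show ?thesis
    by simp
qed

text \<open>Repeatedly deleting a vertex of too small degree must stop at a large set, because the
  deletions remove too few edges.\<close>

lemma min_degree_subset: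
  fixes c :: real and V :: "'v set"
  assumes "finite V" "\<And>e. e \<in> E \<Longrightarrow> card e = 2" "0 \<le> c"
    and "c * (real (card V) * (real (card V) + 1) / 2) + (real N)\<^sup>2 < real (card {e \<in> E. e \<subseteq> V})"
  shows "\<exists>V'\<subseteq>V. N \<le> card V' \<and> (\<forall>v\<in>V'. c * real (card V') \<le> real (card {u \<in> V'. {v, u} \<in> E}))"
  using assms(1,4)
\<comment> \<open>With \<open>n = card V\<close>, the term \<open>c * (n * (n + 1) / 2)\<close> is
  the sum of \<open>c * j\<close> over \<open>j \<le> n\<close>, so deleting a vertex of degree
  below \<open>c * n\<close> preserves the hypothesis. The reserve \<open>N^2\<close> exceeds what
  fewer than \<open>N\<close> vertices can span, so the deletions stop in time.\<close>
proof (induction "card V" arbitrary: V)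
  case 0
  then have "{e \<in> E. e \<subseteq> V} = {}"
    using assms(2) by fastforce
  then have "(real N)\<^sup>2 < 0"
    using 0 by (simp only: 0(1)[symmetric]) simp
  then show ?case
    by simp
next
  case (Suc m)
  show ?case
  proof (cases "\<forall>v\<in>V. c * real (card V) \<le> real (card {u \<in> V. {v, u} \<in> E})")
    case True
    have "(real N)\<^sup>2 \<le> c * (real (card V) * (real (card V) + 1) / 2) + (real N)\<^sup>2"
      using assms(3) by simp
    also have "\<dots> < (real (card V))\<^sup>2"
      using Suc.prems(2) card_edges_le_square[OF Suc.prems(1) assms(2)]
      by (metis (no_types, lifting) of_nat_le_iff of_nat_power order_less_le_trans)
    finally have "N \<le> card V"
      by (simp add: power_less_imp_less_base less_imp_le flip: of_nat_power)
    then show ?thesis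
      using True by blast
  next
    case False
    then obtain v where v: "v \<in> V" "real (card {u \<in> V. {v, u} \<in> E}) < c * real (card V)"
      by auto
    have m: "card (V - {v}) = m"
      using Suc v(1) by simp
    have "real (card {e \<in> E. e \<subseteq> V}) \<le> real (card {e \<in> E. e \<subseteq> V - {v}}) + c * real (Suc m)"
    proof -
      have "card {e \<in> E. e \<subseteq> V} \<le> card {e \<in> E. e \<subseteq> V - {v}} + card {u \<in> V. {v, u} \<in> E}"
        by (rule card_edges_remove_vertex[OF Suc.prems(1) v(1) assms(2)])
      then have "real (card {e \<in> E. e \<subseteq> V}) \<le> real (card {e \<in> E. e \<subseteq> V - {v}}) + real (card {u \<in> V. {v, u} \<in> E})"
        by (simp only: of_nat_add[symmetric] of_nat_le_iff)
      then show ?thesis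
        using v(2) unfolding Suc(2) by linarith
    qed
    moreover have cV: "c * (real (card V) * (real (card V) + 1) / 2) = c * (real m * (real m + 1) / 2) + c * real (Suc m)"
      unfolding Suc(2)[symmetric] by (simp add: field_simps)
    ultimately have "c * (real m * (real m + 1) / 2) + (real N)\<^sup>2 < real (card {e \<in> E. e \<subseteq> V - {v}})"
      using Suc.prems(2) unfolding cV by linarith
    then obtain V' where "V' \<subseteq> V - {v}" "N \<le> card V' \<and>
        (\<forall>v\<in>V'. c * real (card V') \<le> real (card {u \<in> V'. {v, u} \<in> E}))"
      using Suc(1)[of "V - {v}"] m Suc.prems(1) by auto
    then show ?thesis
      by blast
  qed
qed

lemma complete_multipartite_mono:
  "complete_multipartite r t V' E b \<Longrightarrow> V' \<subseteq> V \<Longrightarrow> complete_multipartite r t V E b"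
  by (auto simp: complete_multipartite_def Pi_iff)

text \<open>Deleting vertices of low degree reduces this to the minimum degree version. Half of the
  excess \<open>\<epsilon> * n^2\<close> raises the density to
  \<open>c = 1 - 1 / r + \<epsilon>\<close>; the other half absorbs the lower-order terms
  \<open>c * n / 2\<close> and \<open>N^2\<close>.\<close>

theorem erdos_stone:
  fixes \<epsilon> :: real
  assumes "0 < \<epsilon>" "1 \<le> r"
  shows "\<exists>n0. \<forall>(V :: 'v set) E. finite V \<and> n0 \<le> card V \<and> E \<subseteq> nsets V 2 \<and>
           (1 - 1 / real r) * ((real (card V))\<^sup>2 / 2) + \<epsilon> * (real (card V))\<^sup>2 < real (card E)
         \<longrightarrow> (\<exists>b. complete_multipartite (Suc r) t V E b)"
proof -
  \<comment> \<open>The minimum degree version requires \<open>\<delta> \<le> 1\<close>.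
    Non-neighbours will be bounded through \<open>r * (1 - c) = 1 - r * \<epsilon>\<close>, which is
    at most \<open>1 - \<delta>\<close> as \<open>r \<ge> 1\<close>.\<close>
  define \<delta> where "\<delta> = min 1 \<epsilon>"
  have \<delta>: "0 < \<delta>" "\<delta> \<le> 1" "\<delta> \<le> \<epsilon>"
    using assms by (auto simp: \<delta>_def)
  from complete_multipartite_of_min_degree[OF \<delta>(1,2), of r t]
  obtain N where N: "\<forall>(V :: 'v set) E. finite V \<and> N \<le> card V \<and>
      (\<forall>v\<in>V. real r * real (card {u \<in> V. {v, u} \<notin> E}) \<le> (1 - \<delta>) * real (card V))
      \<longrightarrow> (\<exists>b. complete_multipartite (Suc r) t V E b)" ..
  define c where "c = 1 - 1 / real r + \<epsilon>"
  have c: "0 \<le> c"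
    using assms by (simp add: c_def)
  \<comment> \<open>Ensures \<open>c + 2 * N^2 \<le> \<epsilon> * n\<close>; multiplying by
    \<open>n \<ge> 1\<close> gives the estimate that pays for the lower-order terms.\<close>
  define n0 where "n0 = Suc (nat \<lceil>(c + 2 * (real N)\<^sup>2) / \<epsilon>\<rceil>)"
  show ?thesis
  proof (intro exI[of _ n0] allI impI, elim conjE)
    fix V :: "'v set" and E
    assume fin: "finite V" and n0: "n0 \<le> card V" and E: "E \<subseteq> nsets V 2"
      and large: "(1 - 1 / real r) * ((real (card V))\<^sup>2 / 2) + \<epsilon> * (real (card V))\<^sup>2 < real (card E)"
    have E2: "card e = 2" if "e \<in> E" for e
      using that E by (auto simp: nsets_def)
    let ?n = "real (card V)"
    have "(c + 2 * (real N)\<^sup>2) / \<epsilon> \<le> ?n" "1 \<le> ?n"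
      using n0 unfolding n0_def by linarith+
    then have "c + 2 * (real N)\<^sup>2 \<le> \<epsilon> * ?n"
      using assms(1) by (simp add: field_simps)
    from mult_right_mono[OF this, of ?n] have "c * ?n + 2 * (real N)\<^sup>2 * ?n \<le> \<epsilon> * ?n\<^sup>2"
      by (simp add: algebra_simps power2_eq_square)
    moreover have "2 * (real N)\<^sup>2 \<le> 2 * (real N)\<^sup>2 * ?n"
      using \<open>1 \<le> ?n\<close> mult_left_mono[of 1 ?n "2 * (real N)\<^sup>2"] by simp
    ultimately have 1: "c * ?n + 2 * (real N)\<^sup>2 \<le> \<epsilon> * ?n\<^sup>2"
      by linarith
    have 2: "(1 - 1 / real r) * (?n\<^sup>2 / 2) + \<epsilon> * ?n\<^sup>2 = c * ?n\<^sup>2 / 2 + \<epsilon> * ?n\<^sup>2 / 2"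
      by (simp add: c_def algebra_simps add_divide_distrib diff_divide_distrib)
    have 3: "c * (?n * (?n + 1) / 2) = c * ?n\<^sup>2 / 2 + c * ?n / 2"
      by (simp add: algebra_simps power2_eq_square add_divide_distrib)
    have 4: "{e \<in> E. e \<subseteq> V} = E"
      using E by (auto simp: nsets_def)
    have "c * (?n * (?n + 1) / 2) + (real N)\<^sup>2 < real (card {e \<in> E. e \<subseteq> V})"
      using 1 large unfolding 2 3 4 by linarith
    from min_degree_subset[OF fin E2 c this] obtain V' where V': "V' \<subseteq> V" "N \<le> card V'"
        "\<And>v. v \<in> V' \<Longrightarrow> c * real (card V') \<le> real (card {u \<in> V'. {v, u} \<in> E})"
      by blast
    have "\<exists>b. complete_multipartite (Suc r) t V' E b"
    proof (rule N[rule_format], intro conjI ballI)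
      show fin': "finite V'"
        using V'(1) fin by (rule finite_subset)
      fix v assume "v \<in> V'"
      have "{u \<in> V'. {v, u} \<notin> E} = V' - {u \<in> V'. {v, u} \<in> E}"
        by auto
      then have "card {u \<in> V'. {v, u} \<notin> E} = card V' - card {u \<in> V'. {v, u} \<in> E}"
        using fin' by (simp add: card_Diff_subset)
      moreover have "card {u \<in> V'. {v, u} \<in> E} \<le> card V'"
        using fin' by (intro card_mono) auto
      ultimately have "real (card {u \<in> V'. {v, u} \<notin> E}) \<le> (1 - c) * real (card V')"
        using V'(3)[OF \<open>v \<in> V'\<close>] by (simp add: algebra_simps)
      then have "real r * real (card {u \<in> V'. {v, u} \<notin> E}) \<le> real r * ((1 - c) * real (card V'))"
        by (simp add: mult_left_mono)
      also have "\<dots> = (1 - real r * \<epsilon>) * real (card V')"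
        using assms(2) by (simp add: c_def field_simps)
      also have "\<dots> \<le> (1 - \<delta>) * real (card V')"
      proof (rule mult_right_mono)
        have "\<epsilon> \<le> real r * \<epsilon>"
          using assms mult_right_mono[of 1 "real r" \<epsilon>] by simp
        then show "1 - real r * \<epsilon> \<le> 1 - \<delta>"
          using \<delta>(3) by linarith
      qed simp
      finally show "real r * real (card {u \<in> V'. {v, u} \<notin> E}) \<le> (1 - \<delta>) * real (card V')" .
    qed (use V'(2) in auto)
    then show "\<exists>b. complete_multipartite (Suc r) t V E b"
      using complete_multipartite_mono[OF _ V'(1)] by blast
  qed
qed

section \<open>Ramsey refinements\<close>

text \<open>Ramsey's theorem with equal clique sizes, carried along a bijection from
  \<open>C\<close> to an initial segment of the naturals. General colour sets matter because a
  colour will later be a whole table of edge colours.\<close>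

lemma ramsey_finite_colour_set:
  assumes "finite C"
  shows "\<exists>N. \<forall>f \<in> nsets {..<N::nat} 2 \<rightarrow> C. \<exists>M c. M \<subseteq> {..<N} \<and> card M = m \<and> c \<in> C \<and> (\<forall>e\<in>nsets M 2. f e = c)"
proof -
  obtain h where h: "bij_betw h C {0..<card C}"
    using ex_bij_betw_finite_nat[OF assms] by blast
  from ramsey_full[of "replicate (card C) m" 2] obtain N :: nat where N: "partn_lst {..<N} (replicate (card C) m) 2" ..
  show ?thesis
  proof (intro exI[of _ N] ballI)
    fix f assume f: "f \<in> nsets {..<N} 2 \<rightarrow> C"
    then have "h \<circ> f \<in> nsets {..<N} 2 \<rightarrow> {..<length (replicate (card C) m)}"
      using bij_betwE[OF h] by (auto simp: Pi_iff)
    then obtain i M where i: "i < card C" and M: "M \<in> nsets {..<N} m" "(h \<circ> f) ` nsets M 2 \<subseteq> {i}"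
      using N unfolding partn_lst_def monochromatic_def by fastforce
    have "i \<in> h ` C"
      using i h by (simp add: bij_betw_def)
    then obtain c where c: "c \<in> C" "h c = i"
      by blast
    have sub: "M \<subseteq> {..<N}"
      using M(1) by (simp add: nsets_def)
    have "f e = c" if e: "e \<in> nsets M 2" for e
    proof -
      have "h (f e) = h c"
        using M(2) e c(2) by auto
      moreover have "f e \<in> C"
        using f e nsets_mono[OF sub, of 2] by blast
      ultimately show ?thesis
        using h c(1) by (auto simp: bij_betw_def inj_on_def)
    qed
    then show "\<exists>M c. M \<subseteq> {..<N} \<and> card M = m \<and> c \<in> C \<and> (\<forall>e\<in>nsets M 2. f e = c)"
      using M(1) sub c(1) by (intro exI[of _ M] exI[of _ c]) (auto simp: nsets_def)
  qed
qed

lemma complete_multipartite_reindex: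
  assumes "complete_multipartite r T V E b"
    and "\<And>i x. i \<in> {1..r} \<Longrightarrow> x < s \<Longrightarrow> h i x < T"
    and "\<And>i. i \<in> {1..r} \<Longrightarrow> inj_on (h i) {..<s}"
  shows "complete_multipartite r s V E (\<lambda>i x. b i (h i x))"
  unfolding complete_multipartite_def
proof (intro conjI ballI impI allI)
  fix i assume i: "i \<in> {1..r}"
  then have b: "b i \<in> {..<T} \<rightarrow> V" "inj_on (b i) {..<T}"
    using assms(1) by (simp_all add: complete_multipartite_def)
  then show "(\<lambda>x. b i (h i x)) \<in> {..<s} \<rightarrow> V"
    using assms(2)[OF i] by (simp add: Pi_iff)
  show "inj_on (\<lambda>x. b i (h i x)) {..<s}"
    using b(2) assms(2,3)[OF i] by (simp add: inj_on_def)
next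
  fix i j x y
  assume "i \<in> {1..r}" "j \<in> {1..r}" "i \<noteq> j" "x < s" "y < s"
  then show "{b i (h i x), b j (h j y)} \<in> E"
    using assms(1,2) by (simp add: complete_multipartite_def)
qed

text \<open>A single application of Ramsey's theorem to pairs of indices makes all the parts and all the
  pairs of parts monochromatic: the colour of \<open>p < q\<close> records the colours of \<open>{b i p, b j q}\<close>
  for all \<open>i, j\<close>, and part \<open>i\<close> takes its vertices from the \<open>i\<close>-th block of a homogeneous set.\<close>

lemma homogeneous_complete_multipartite:
  "\<exists>T. \<forall>V E b \<phi>. complete_multipartite r T (V :: 'v set) E b \<and> E \<subseteq> nsets V 2 \<and> \<phi> \<in> nsets V 2 \<rightarrow> {1..k::nat} \<longrightarrow>
     (\<exists>b' c. complete_multipartite r s V E b' \<and>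
        (\<forall>i\<in>{1..r}. \<forall>j\<in>{1..r}. c i j \<in> {1..k}) \<and>
        (\<forall>i\<in>{1..r}. \<forall>x<s. \<forall>y<s. x \<noteq> y \<longrightarrow> \<phi> {b' i x, b' i y} = c i i) \<and>
        (\<forall>i\<in>{1..r}. \<forall>j\<in>{1..r}. i < j \<longrightarrow> (\<forall>x<s. \<forall>y<s. \<phi> {b' i x, b' j y} = c i j)))"
proof -
  let ?C = "({1..r} \<times> {1..r}) \<rightarrow>\<^sub>E {1..k}"
  have "finite ?C"
    by (intro finite_PiE) auto
  from ramsey_finite_colour_set[OF this, of "r * s"] obtain T :: nat
    where T: "\<forall>f \<in> nsets {..<T} 2 \<rightarrow> ?C. \<exists>M c. M \<subseteq> {..<T} \<and> card M = r * s \<and> c \<in> ?C \<and> (\<forall>e\<in>nsets M 2. f e = c)"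
    by (elim exE)
  show ?thesis
  proof (intro exI[of _ T] allI impI, elim conjE)
    fix V :: "'v set" and E b \<phi>
    assume b: "complete_multipartite r T V E b" and E: "E \<subseteq> nsets V 2" and \<phi>: "\<phi> \<in> nsets V 2 \<rightarrow> {1..k}"
    \<comment> \<open>\<open>Min\<close> and \<open>Max\<close> recover the order of the pair, so
      entry \<open>(i, j)\<close> takes the smaller index in part \<open>i\<close>. The restriction
      places the table in the finite set \<open>?C\<close>.\<close>
    define f where "f e = (\<lambda>(i, j) \<in> {1..r} \<times> {1..r}. \<phi> {b i (Min e), b j (Max e)})" for e
    have bpair: "{b i p, b j q} \<in> nsets V 2"
      if ij: "i \<in> {1..r}" "j \<in> {1..r}" and pq: "p < q" "q < T" for i j p q
    proof (cases "i = j")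
      case True
      have "b i \<in> {..<T} \<rightarrow> V" "inj_on (b i) {..<T}"
        using b ij by (simp_all add: complete_multipartite_def)
      then show ?thesis
        using True pq by (auto simp: Pi_iff dest: inj_onD)
    next
      case False
      then have "{b i p, b j q} \<in> E"
        using b ij pq by (simp add: complete_multipartite_def)
      then show ?thesis
        using E by blast
    qed
    have "f \<in> nsets {..<T} 2 \<rightarrow> ?C"
    proof
      fix e assume "e \<in> nsets {..<T} 2"
      then obtain p q where e: "e = {p, q}" "p < q" "q < T"
        unfolding ordered_nsets_2_eq by auto
      then have f: "f e = (\<lambda>(i, j) \<in> {1..r} \<times> {1..r}. \<phi> {b i p, b j q})"
        by (simp add: f_def)
      show "f e \<in> ?C"
        unfolding f by (rule restrict_PiE_iff[THEN iffD2]) (use bpair e(2,3) \<phi> in \<open>auto simp: Pi_iff\<close>)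
    qed
    from T[rule_format, OF this] obtain M c where
      M: "M \<subseteq> {..<T}" "card M = r * s" and c: "c \<in> ?C" "\<forall>e\<in>nsets M 2. f e = c"
      by blast
    have finM: "finite M"
      using M(1) finite_subset by blast
    \<comment> \<open>The case \<open>i = j\<close> is included and governs the edges inside a
      part.\<close>
    have col: "\<phi> {b i p, b j q} = c (i, j)"
      if "i \<in> {1..r}" "j \<in> {1..r}" "p \<in> M" "q \<in> M" "p < q" for i j p q
    proof -
      have "f {p, q} = c"
        using c(2) that by simp
      moreover have "f {p, q} (i, j) = \<phi> {b i p, b j q}"
        using that by (simp add: f_def)
      ultimately show ?thesis
        by simp
    qed
    define g where "g q = sorted_list_of_set M ! q" for q
    have g: "g q \<in> M" if "q < r * s" for q
      using that M(2) finM unfolding g_def by (metis length_sorted_list_of_set nth_mem set_sorted_list_of_set)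
    have gmono: "g p < g q" if "p < q" "q < r * s" for p q
      using that M(2) sorted_wrt_nth_less[OF strict_sorted_list_of_set[of M], of p q] by (simp add: g_def)
    \<comment> \<open>Blocks of \<open>s\<close> consecutive elements of \<open>M\<close>, with
      offset \<open>i - 1\<close> because parts are numbered from 1. For \<open>i < j\<close> block
      \<open>i\<close> lies below block \<open>j\<close>, the order in which \<open>f\<close>
      records entry \<open>(i, j)\<close>.\<close>
    define h where "h i x = g ((i - 1) * s + x)" for i x
    have idx: "(i - 1) * s + x < r * s" if "i \<in> {1..r}" "x < s" for i x
    proof -
      have "(i - 1) * s + x < (i - 1) * s + s"
        using that by simp
      also have "\<dots> = i * s"
        using that by (cases i) auto
      also have "\<dots> \<le> r * s"
        using that by simp
      finally show ?thesis .
    qed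
    have hM: "h i x \<in> M" if "i \<in> {1..r}" "x < s" for i x
      unfolding h_def using g idx that by blast
    have hmono: "h i x < h i y" if "i \<in> {1..r}" "x < y" "y < s" for i x y
      unfolding h_def using that by (intro gmono idx) auto
    have hless: "h i x < h j y" if "i \<in> {1..r}" "j \<in> {1..r}" "i < j" "x < s" "y < s" for i j x y
      unfolding h_def
    proof (rule gmono)
      have "(i - 1) * s + x < (i - 1) * s + s"
        using that by simp
      also have "\<dots> = i * s"
        using that by (cases i) auto
      also have "\<dots> \<le> (j - 1) * s"
        using that by (intro mult_right_mono) auto
      finally show "(i - 1) * s + x < (j - 1) * s + y"
        by simp
    qed (use idx that in auto)
    have hinj: "inj_on (h i) {..<s}" if "i \<in> {1..r}" for i
      by (rule inj_onI) (metis hmono that lessThan_iff linorder_neqE_nat less_irrefl)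
    let ?b = "\<lambda>i x. b i (h i x)"
    have "complete_multipartite r s V E ?b"
      using hM M(1) hinj by (intro complete_multipartite_reindex[OF b]) auto
    moreover have "c (i, j) \<in> {1..k}" if "i \<in> {1..r}" "j \<in> {1..r}" for i j
      using PiE_mem[OF c(1), of "(i, j)"] that by simp
    moreover have "\<phi> {?b i x, ?b i y} = c (i, i)" if "i \<in> {1..r}" "x < s" "y < s" "x \<noteq> y" for i x y
    proof (cases "x < y")
      case True
      then show ?thesis
        using that by (intro col hM hmono) auto
    next
      case False
      then have "\<phi> {?b i y, ?b i x} = c (i, i)"
        using that by (intro col hM hmono) auto
      then show ?thesis
        by (simp add: insert_commute)
    qed
    moreover have "\<phi> {?b i x, ?b j y} = c (i, j)"
      if "i \<in> {1..r}" "j \<in> {1..r}" "i < j" "x < s" "y < s" for i j x y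
      using that by (intro col hM hless) auto
    ultimately show "\<exists>b' c. complete_multipartite r s V E b' \<and>
        (\<forall>i\<in>{1..r}. \<forall>j\<in>{1..r}. c i j \<in> {1..k}) \<and>
        (\<forall>i\<in>{1..r}. \<forall>x<s. \<forall>y<s. x \<noteq> y \<longrightarrow> \<phi> {b' i x, b' i y} = c i i) \<and>
        (\<forall>i\<in>{1..r}. \<forall>j\<in>{1..r}. i < j \<longrightarrow> (\<forall>x<s. \<forall>y<s. \<phi> {b' i x, b' j y} = c i j))"
      by (intro exI[of _ ?b] exI[of _ "\<lambda>i j. c (i, j)"] conjI ballI allI impI) blast+
  qed
qed

section \<open>NIM-edges and feasible colourings\<close>

lemma edge_doubleton:
  assumes "fin_simple_graph G" "e \<in> edges G"
  obtains u v where "e = {u, v}" "u \<in> verts G" "v \<in> verts G" "u \<noteq> v"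
proof -
  have "e \<in> nsets (verts G) 2"
    using assms by (auto simp: fin_simple_graph_def)
  then show thesis
    by (metis nsets2_E that)
qed

text \<open>An edgeless graph is bipartite with one side empty. This supplies the edge of
  \<open>H i\<close> on which contradictions are reached.\<close>

lemma edges_nonempty_if_not_bipartite: "\<not> bipartite G \<Longrightarrow> edges G \<noteq> {}"
  unfolding bipartite_def by (metis Int_empty_right Un_empty_right empty_iff)

lemma finite_complete_graph_edges: "finite (edges (complete_graph n))"
  by (simp add: complete_graph_def finite_imp_finite_nsets)

lemma nim_edges_subset: "nim_edges k H n \<phi> \<subseteq> nsets {1..n} 2"
  by (auto simp: nim_edges_def complete_graph_def)

lemma finite_nim_values: "finite {card (nim_edges k H n \<phi>) | \<phi>. edge_colouring k n \<phi>}"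
proof (rule finite_subset)
  show "{card (nim_edges k H n \<phi>) | \<phi>. edge_colouring k n \<phi>} \<subseteq> {..card (edges (complete_graph n))}"
    using finite_complete_graph_edges by (auto intro!: card_mono simp: nim_edges_def)
qed simp

lemma card_nim_edges_le_nim: "edge_colouring k n \<phi> \<Longrightarrow> card (nim_edges k H n \<phi>) \<le> nim k H n"
  unfolding nim_def by (intro Max_ge finite_nim_values) blast

lemma nim_attained:
  assumes "1 \<le> k"
  obtains \<phi> where "edge_colouring k n \<phi>" "card (nim_edges k H n \<phi>) = nim k H n"
proof -
  have "edge_colouring k n (\<lambda>_. 1)"
    using assms by (simp add: edge_colouring_def)
  then have "nim k H n \<in> {card (nim_edges k H n \<phi>) | \<phi>. edge_colouring k n \<phi>}"
    unfolding nim_def by (intro Max_in finite_nim_values) blast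
  then show thesis
    using that by auto
qed

text \<open>The injective image of \<open>H i\<close> is itself a forbidden copy. Both feasibility
  conditions will be derived by building such an image with at least one NIM-edge in it.\<close>

lemma nim_edge_not_in_monochromatic_image:
  assumes "i \<in> {1..k}" "fin_simple_graph (H i)"
    and "inj_on g (verts (H i))" "g \<in> verts (H i) \<rightarrow> {1..n}"
    and "\<And>e. e \<in> edges (H i) \<Longrightarrow> \<phi> (g ` e) = i" "e \<in> edges (H i)"
  shows "g ` e \<notin> nim_edges k H n \<phi>"
proof
  assume nim: "g ` e \<in> nim_edges k H n \<phi>"
  let ?F = "(g ` verts (H i), (`) g ` edges (H i))"
  have "g ` e' \<in> nsets {1..n} 2" if e': "e' \<in> edges (H i)" for e'
  proof -
    obtain u v where "e' = {u, v}" "u \<in> verts (H i)" "v \<in> verts (H i)" "u \<noteq> v"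
      using edge_doubleton[OF assms(2) e'] .
    then show ?thesis
      using assms(3,4) by (auto simp: Pi_iff dest: inj_onD)
  qed
  then have "is_copy_in ?F (H i) (complete_graph n)"
    using assms(3,4) unfolding is_copy_in_def subgraph_def graph_iso_def complete_graph_def
    by (auto simp: bij_betw_def intro!: exI[of _ g])
  moreover have "\<forall>e'\<in>edges ?F. \<phi> e' = i"
    using assms(5) by auto
  moreover have "g ` e \<in> edges ?F"
    using assms(6) by simp
  ultimately show False
    using nim assms(1) unfolding nim_edges_def by blast
qed

text \<open>Since \<open>s\<close> is at least the order of every \<open>H i\<close>, the vertices
  of \<open>H i\<close> receive distinct labels below \<open>s\<close>, so even a map sending many
  vertices to one part lifts to an injection. \<open>Min\<close> and \<open>Max\<close> read a pair
  in the order for which \<open>c\<close> is known and turn \<open>{a}\<close> into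
  \<open>c a a\<close>.\<close>

lemma feasible_if_homogeneous:
  assumes k: "1 \<le> k"
    and H: "\<And>i. i \<in> {1..k} \<Longrightarrow> fin_simple_graph (H i)" "\<And>i. i \<in> {1..k} \<Longrightarrow> \<not> bipartite (H i)"
    and s: "\<And>i. i \<in> {1..k} \<Longrightarrow> card (verts (H i)) \<le> s"
    and b: "complete_multipartite r s {1..n} (nim_edges k H n \<phi>) b"
    and c: "\<And>i j. i \<in> {1..r} \<Longrightarrow> j \<in> {1..r} \<Longrightarrow> c i j \<in> {1..k}"
    and inside: "\<And>i x y. \<lbrakk>i \<in> {1..r}; x < s; y < s; x \<noteq> y\<rbrakk> \<Longrightarrow> \<phi> {b i x, b i y} = c i i"
    and across: "\<And>i j x y. \<lbrakk>i \<in> {1..r}; j \<in> {1..r}; i < j; x < s; y < s\<rbrakk> \<Longrightarrow> \<phi> {b i x, b j y} = c i j"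
  shows "feasible k H r (\<lambda>S. if S = {} then 1 else c (Min S) (Max S))"
    (is "feasible k H r ?\<xi>")
proof -
  have cross: "\<phi> {b i x, b j y} = ?\<xi> {i, j}"
    if "i \<in> {1..r}" "j \<in> {1..r}" "i \<noteq> j" "x < s" "y < s" for i j x y
  proof (cases "i < j")
    case True
    then show ?thesis
      using across that by simp
  next
    case False
    then have "j < i"
      using that by simp
    then show ?thesis
      using across[of j i y x] that by (simp add: insert_commute)
  qed
  have nim: "{b i x, b j y} \<in> nim_edges k H n \<phi>"
    if "i \<in> {1..r}" "j \<in> {1..r}" "i \<noteq> j" "x < s" "y < s" for i j x y
    using b that by (simp add: complete_multipartite_def)
  have bn: "b i x \<in> {1..n}" if "i \<in> {1..r}" "x < s" for i x
    using b that unfolding complete_multipartite_def by blast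
  have binj: "b i x = b i y \<longleftrightarrow> x = y" if "i \<in> {1..r}" "x < s" "y < s" for i x y
    using b that unfolding complete_multipartite_def by (meson inj_on_eq_iff lessThan_iff)
  have bdisj: "b i x \<noteq> b j y" if "i \<in> {1..r}" "j \<in> {1..r}" "i \<noteq> j" "x < s" "y < s" for i j x y
  proof -
    have "{b i x, b j y} \<in> nsets {1..n} 2"
      using nim[OF that] nim_edges_subset by blast
    then show ?thesis
      by simp
  qed
  have label: "\<exists>h. (\<forall>v\<in>verts (H i). h v < s) \<and> inj_on h (verts (H i))" if "i \<in> {1..k}" for i
    using card_le_inj[of "verts (H i)" "{..<s}"] H(1)[OF that] s[OF that]
    by (auto simp: fin_simple_graph_def image_subset_iff)
  \<comment> \<open>The empty set is also coloured; its default colour 1 is legitimate because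
    \<open>k \<ge> 1\<close>.\<close>
  have "?\<xi> \<in> {S. S \<subseteq> {1..r} \<and> card S \<le> 2} \<rightarrow> {1..k}"
  proof
    fix S assume "S \<in> {S. S \<subseteq> {1..r} \<and> card S \<le> 2}"
    then have S: "S \<subseteq> {1..r}" "finite S"
      by (auto intro: finite_subset)
    show "?\<xi> S \<in> {1..k}"
    proof (cases "S = {}")
      case False
      then have "Min S \<in> {1..r}" "Max S \<in> {1..r}"
        using S Min_in Max_in by blast+
      then show ?thesis
        using False c by simp
    qed (use k in simp)
  qed
  moreover have "\<not> graph_hom f (H i) (colour_graph r ?\<xi> i)" if i: "i \<in> {1..k}" for i f
  proof
    assume f: "graph_hom f (H i) (colour_graph r ?\<xi> i)"
    have fr: "f v \<in> {1..r}" if "v \<in> verts (H i)" for v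
      using f that by (auto simp: graph_hom_def colour_graph_def)
    have fe: "f u \<noteq> f v \<and> ?\<xi> {f u, f v} = i" if "{u, v} \<in> edges (H i)" for u v
    proof -
      have "f ` {u, v} \<in> {e \<in> nsets {1..r} 2. ?\<xi> e = i}"
        using f that unfolding graph_hom_def colour_graph_def by fastforce
      then show ?thesis
        by simp
    qed
    obtain h where h: "\<And>v. v \<in> verts (H i) \<Longrightarrow> h v < s" "inj_on h (verts (H i))"
      using label[OF i] by blast
    \<comment> \<open>The homomorphism selects the part and the label selects the vertex in it.
      Adjacent vertices go to different parts, so all edges of the image are NIM-edges.\<close>
    define g where "g v = b (f v) (h v)" for v
    have "inj_on g (verts (H i))"
    proof (rule inj_onI)
      fix u v assume uv: "u \<in> verts (H i)" "v \<in> verts (H i)" "g u = g v"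
      then have "f u = f v"
        using bdisj[OF fr fr _ h(1) h(1)] unfolding g_def by blast
      then have "h u = h v"
        using uv binj[OF fr h(1) h(1)] by (simp add: g_def)
      then show "u = v"
        using h(2) uv by (simp add: inj_on_eq_iff)
    qed
    moreover have "g \<in> verts (H i) \<rightarrow> {1..n}"
      unfolding g_def using bn fr h(1) by blast
    moreover have "\<phi> (g ` e) = i \<and> g ` e \<in> nim_edges k H n \<phi>" if e: "e \<in> edges (H i)" for e
    proof -
      obtain u v where uv: "e = {u, v}" "u \<in> verts (H i)" "v \<in> verts (H i)"
        using edge_doubleton[OF H(1)[OF i] e] .
      have fuv: "f u \<noteq> f v" "?\<xi> {f u, f v} = i"
        using fe e unfolding uv(1) by blast+
      have "g ` e = {b (f u) (h u), b (f v) (h v)}"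
        by (simp add: uv(1) g_def)
      then show ?thesis
        using cross[OF fr[OF uv(2)] fr[OF uv(3)] fuv(1) h(1)[OF uv(2)] h(1)[OF uv(3)]]
          nim[OF fr[OF uv(2)] fr[OF uv(3)] fuv(1) h(1)[OF uv(2)] h(1)[OF uv(3)]] fuv(2)
        by metis
    qed
    moreover obtain e where "e \<in> edges (H i)"
      using edges_nonempty_if_not_bipartite[OF H(2)[OF i]] by blast
    ultimately show False
      using nim_edge_not_in_monochromatic_image[of i k H g n \<phi> e, OF i H(1)[OF i]] by blast
  qed
  moreover have "?\<xi> {a, a'} \<noteq> ?\<xi> {a}" if a: "a \<in> {1..r}" "a' \<in> {1..r}" "a \<noteq> a'" for a a'
  proof
    define i where "i = ?\<xi> {a}"
    assume "?\<xi> {a, a'} = ?\<xi> {a}"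
    then have \<xi>: "?\<xi> {a, a'} = i"
      by (simp add: i_def)
    have caa: "c a a = i"
      by (simp add: i_def)
    then have i: "i \<in> {1..k}"
      using c a(1) by blast
    obtain e where e: "e \<in> edges (H i)"
      using edges_nonempty_if_not_bipartite[OF H(2)[OF i]] by blast
    then obtain w z where wz: "e = {w, z}" "w \<in> verts (H i)" "z \<in> verts (H i)" "w \<noteq> z"
      using edge_doubleton[OF H(1)[OF i]] by metis
    obtain h where h: "\<And>v. v \<in> verts (H i) \<Longrightarrow> h v < s" "inj_on h (verts (H i))"
      using label[OF i] by blast
    \<comment> \<open>Edges at \<open>w\<close> cross between the parts with colour
      \<open>?\<xi> {a, a'}\<close>, all others lie inside part \<open>a\<close> with colour
      \<open>c a a\<close>; both colours are \<open>i\<close>. The image of \<open>e\<close> crosses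
      and is therefore a NIM-edge.\<close>
    define g where "g v = b (if v = w then a' else a) (h v)" for v
    have "inj_on g (verts (H i))"
    proof (rule inj_onI)
      fix u v assume uv: "u \<in> verts (H i)" "v \<in> verts (H i)" "g u = g v"
      show "u = v"
      proof (cases "u = w \<longleftrightarrow> v = w")
        case True
        then have "h u = h v"
          using uv a binj h(1) by (auto simp: g_def split: if_splits)
        then show ?thesis
          using h(2) uv by (simp add: inj_on_eq_iff)
      next
        case False
        then show ?thesis
          using uv bdisj[OF a(1,2,3), of "h u" "h v"] bdisj[OF a(1,2,3), of "h v" "h u"] h(1)
          by (auto simp: g_def split: if_splits)
      qed
    qed
    moreover have "g \<in> verts (H i) \<rightarrow> {1..n}"
      using bn a h(1) by (auto simp: g_def)
    moreover have "\<phi> (g ` e') = i" if e': "e' \<in> edges (H i)" for e'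
    proof -
      obtain u v where uv: "e' = {u, v}" "u \<in> verts (H i)" "v \<in> verts (H i)" "u \<noteq> v"
        using edge_doubleton[OF H(1)[OF i] e'] .
      have hne: "h u \<noteq> h v"
        using h(2) uv by (simp add: inj_on_eq_iff)
      have img: "g ` e' = {g u, g v}"
        by (simp add: uv(1))
      consider "u = w" "v \<noteq> w" | "v = w" "u \<noteq> w" | "u \<noteq> w" "v \<noteq> w"
        using uv(4) by blast
      then show ?thesis
      proof cases
        case 1
        then show ?thesis
          using cross[OF a(2,1), of "h u" "h v"] a(3) h(1) uv(2,3) \<xi> unfolding img
          by (simp add: g_def insert_commute)
      next
        case 2
        then show ?thesis
          using cross[OF a(1,2,3), of "h u" "h v"] h(1) uv(2,3) \<xi> unfolding img
          by (simp add: g_def)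
      next
        case 3
        then show ?thesis
          using inside[OF a(1) h(1)[OF uv(2)] h(1)[OF uv(3)] hne] caa unfolding img
          by (simp add: g_def)
      qed
    qed
    moreover have "g ` e \<in> nim_edges k H n \<phi>"
      using nim[OF a(2,1) a(3)[symmetric], of "h w" "h z"] h(1) wz by (simp add: g_def)
    ultimately show False
      using nim_edge_not_in_monochromatic_image[of i k H g n \<phi> e, OF i H(1)[OF i]] e by blast
  qed
  ultimately show ?thesis
    unfolding feasible_def by blast
qed

section \<open>Existence and extremality of \<open>r_star\<close>\<close>

lemma finite_feasible_sizes:
  assumes "\<And>i. i \<in> {1..k} \<Longrightarrow> fin_simple_graph (H i)"
  shows "finite {r. \<exists>\<xi>. feasible k H r \<xi>}"
proof -
  \<comment> \<open>A sum bounds the order of every \<open>H c\<close>, whichever colour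
    \<open>c\<close> Ramsey's theorem returns.\<close>
  define m where "m = (\<Sum>i\<in>{1..k}. card (verts (H i)))"
  have "finite {1..k}"
    by simp
  from ramsey_finite_colour_set[OF this, of m] obtain N :: nat where
    N: "\<forall>f \<in> nsets {..<N} 2 \<rightarrow> {1..k}. \<exists>M c. M \<subseteq> {..<N} \<and> card M = m \<and> c \<in> {1..k} \<and> (\<forall>e\<in>nsets M 2. f e = c)"
    by (elim exE)
  have "r < N" if \<xi>: "feasible k H r \<xi>" for r \<xi>
  proof (rule ccontr)
    assume "\<not> r < N"
    \<comment> \<open>\<open>Suc\<close> moves the Ramsey vertices \<open>{..<N}\<close> into the
      points \<open>{1..r}\<close>.\<close>
    have "(\<lambda>e. \<xi> (Suc ` e)) \<in> nsets {..<N} 2 \<rightarrow> {1..k}"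
    proof
      fix e assume "e \<in> nsets {..<N} 2"
      then have "Suc ` e \<subseteq> {1..r}" "card (Suc ` e) \<le> 2"
        using \<open>\<not> r < N\<close> by (auto simp: nsets_def card_image)
      then show "\<xi> (Suc ` e) \<in> {1..k}"
        using \<xi> unfolding feasible_def by blast
    qed
    from N[rule_format, OF this] obtain M c where
      M: "M \<subseteq> {..<N}" "card M = m" and c: "c \<in> {1..k}" "\<And>e. e \<in> nsets M 2 \<Longrightarrow> \<xi> (Suc ` e) = c"
      by blast
    have "card (verts (H c)) \<le> m"
      unfolding m_def using c(1) by (intro member_le_sum) auto
    moreover have "finite M"
      using M(1) finite_subset by blast
    ultimately obtain h where h: "h ` verts (H c) \<subseteq> M" "inj_on h (verts (H c))"
      using card_le_inj[of "verts (H c)" M] assms[OF c(1)] M(2) by (auto simp: fin_simple_graph_def)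
    have "graph_hom (Suc \<circ> h) (H c) (colour_graph r \<xi> c)"
      unfolding graph_hom_def
    proof (intro conjI ballI)
      show "Suc \<circ> h \<in> verts (H c) \<rightarrow> verts (colour_graph r \<xi> c)"
        using h(1) M(1) \<open>\<not> r < N\<close> by (fastforce simp: colour_graph_def)
    next
      fix e assume "e \<in> edges (H c)"
      then obtain u v where uv: "e = {u, v}" "u \<in> verts (H c)" "v \<in> verts (H c)" "u \<noteq> v"
        using edge_doubleton[OF assms[OF c(1)]] by metis
      then have huv: "h u \<in> M" "h v \<in> M" "h u \<noteq> h v"
        using h by (auto simp: inj_on_eq_iff)
      then have "\<xi> (Suc ` {h u, h v}) = c"
        by (intro c(2)) simp
      moreover have "h u < r" "h v < r"
        using huv M(1) \<open>\<not> r < N\<close> by auto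
      ultimately show "(Suc \<circ> h) ` e \<in> edges (colour_graph r \<xi> c)"
        using huv(3) by (simp add: uv(1) colour_graph_def)
    qed
    then show False
      using \<xi> c(1) unfolding feasible_def by blast
  qed
  then show ?thesis
    by (auto intro: finite_subset[OF _ finite_lessThan[of N]])
qed

lemma feasible_one:
  assumes "1 \<le> k" "\<And>i. i \<in> {1..k} \<Longrightarrow> \<not> bipartite (H i)"
  shows "feasible k H 1 (\<lambda>_. 1)"
proof -
  have "\<not> graph_hom f (H i) (colour_graph 1 (\<lambda>_. 1) i)" if "i \<in> {1..k}" for i f
    using edges_nonempty_if_not_bipartite[OF assms(2)[OF that]]
    by (auto simp: graph_hom_def colour_graph_def nsets_singleton_iff)
  then show ?thesis
    using assms(1) by (auto simp: feasible_def)
qed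

lemma r_star_bounds:
  assumes "1 \<le> k" "\<And>i. i \<in> {1..k} \<Longrightarrow> fin_simple_graph (H i)" "\<And>i. i \<in> {1..k} \<Longrightarrow> \<not> bipartite (H i)"
  shows r_star_ge_one: "1 \<le> r_star k H"
    and feasible_r_star: "\<exists>\<xi>. feasible k H (r_star k H) \<xi>"
    and feasible_le_r_star: "feasible k H r \<xi> \<Longrightarrow> r \<le> r_star k H"
proof -
  have fin: "finite {r. \<exists>\<xi>. feasible k H r \<xi>}"
    using assms(2) by (rule finite_feasible_sizes)
  have 1: "1 \<in> {r. \<exists>\<xi>. feasible k H r \<xi>}"
    using feasible_one[of k H, OF assms(1,3)] by blast
  show "1 \<le> r_star k H"
    unfolding r_star_def using fin 1 by (rule Max_ge)
  have "r_star k H \<in> {r. \<exists>\<xi>. feasible k H r \<xi>}"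
    unfolding r_star_def using 1 by (intro Max_in fin) blast
  then show "\<exists>\<xi>. feasible k H (r_star k H) \<xi>"
    by simp
  show "r \<le> r_star k H" if "feasible k H r \<xi>"
    unfolding r_star_def using that by (intro Max_ge fin) blast
qed

section \<open>The asymptotic upper bound\<close>

theorem nim_upper_bound:
  fixes \<epsilon> :: real
  assumes k: "1 \<le> k"
    and H: "\<And>i. i \<in> {1..k} \<Longrightarrow> fin_simple_graph (H i)" "\<And>i. i \<in> {1..k} \<Longrightarrow> \<not> bipartite (H i)"
    and \<epsilon>: "0 < \<epsilon>"
  shows "\<exists>n0. \<forall>n\<ge>n0.
    real (nim k H n) \<le> (1 - 1 / real (r_star k H)) * ((real n)\<^sup>2 / 2) + \<epsilon> * (real n)\<^sup>2"
proof -
  define r where "r = r_star k H"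
  \<comment> \<open>Constants are chosen backwards: \<open>s\<close> accommodates every
    \<open>H i\<close>, \<open>T\<close> suffices for a Ramsey refinement to parts of size
    \<open>s\<close>, and \<open>n0\<close> guarantees \<open>r + 1\<close> parts of size
    \<open>T\<close>.\<close>
  define s where "s = (\<Sum>i\<in>{1..k}. card (verts (H i)))"
  have r: "1 \<le> r"
    unfolding r_def using k H by (rule r_star_ge_one)
  have s: "card (verts (H i)) \<le> s" if "i \<in> {1..k}" for i
    unfolding s_def using that by (intro member_le_sum) auto
  from homogeneous_complete_multipartite[of "Suc r" k s] obtain T where
    T: "\<forall>(V :: nat set) E b \<phi>. complete_multipartite (Suc r) T V E b \<and> E \<subseteq> nsets V 2 \<and> \<phi> \<in> nsets V 2 \<rightarrow> {1..k} \<longrightarrow>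
     (\<exists>b' c. complete_multipartite (Suc r) s V E b' \<and>
        (\<forall>i\<in>{1..Suc r}. \<forall>j\<in>{1..Suc r}. c i j \<in> {1..k}) \<and>
        (\<forall>i\<in>{1..Suc r}. \<forall>x<s. \<forall>y<s. x \<noteq> y \<longrightarrow> \<phi> {b' i x, b' i y} = c i i) \<and>
        (\<forall>i\<in>{1..Suc r}. \<forall>j\<in>{1..Suc r}. i < j \<longrightarrow> (\<forall>x<s. \<forall>y<s. \<phi> {b' i x, b' j y} = c i j)))" ..
  from erdos_stone[OF \<epsilon> r, of T] obtain n0 where
    n0: "\<forall>(V :: nat set) E. finite V \<and> n0 \<le> card V \<and> E \<subseteq> nsets V 2 \<and>
           (1 - 1 / real r) * ((real (card V))\<^sup>2 / 2) + \<epsilon> * (real (card V))\<^sup>2 < real (card E)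
         \<longrightarrow> (\<exists>b. complete_multipartite (Suc r) T V E b)" ..
  show ?thesis
  proof (intro exI[of _ n0] allI impI, rule ccontr)
    fix n assume n: "n0 \<le> n"
      and large: "\<not> real (nim k H n) \<le> (1 - 1 / real (r_star k H)) * ((real n)\<^sup>2 / 2) + \<epsilon> * (real n)\<^sup>2"
    obtain \<phi> where \<phi>: "edge_colouring k n \<phi>" "card (nim_edges k H n \<phi>) = nim k H n"
      using k by (rule nim_attained)
    have "\<exists>b. complete_multipartite (Suc r) T {1..n} (nim_edges k H n \<phi>) b"
      using n large nim_edges_subset[of k H n \<phi>]
      by (intro n0[rule_format]) (simp add: \<phi>(2) r_def not_le)
    then obtain b where b: "complete_multipartite (Suc r) T {1..n} (nim_edges k H n \<phi>) b" ..
    moreover have "\<phi> \<in> nsets {1..n} 2 \<rightarrow> {1..k}"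
      using \<phi>(1) by (simp add: edge_colouring_def complete_graph_def)
    ultimately obtain b' c where
      b': "complete_multipartite (Suc r) s {1..n} (nim_edges k H n \<phi>) b'" and
      c: "\<forall>i\<in>{1..Suc r}. \<forall>j\<in>{1..Suc r}. c i j \<in> {1..k}"
        "\<forall>i\<in>{1..Suc r}. \<forall>x<s. \<forall>y<s. x \<noteq> y \<longrightarrow> \<phi> {b' i x, b' i y} = c i i"
        "\<forall>i\<in>{1..Suc r}. \<forall>j\<in>{1..Suc r}. i < j \<longrightarrow> (\<forall>x<s. \<forall>y<s. \<phi> {b' i x, b' j y} = c i j)"
      using T[rule_format, of "{1..n}" "nim_edges k H n \<phi>" b \<phi>] nim_edges_subset[of k H n \<phi>] by auto
    have "feasible k H (Suc r) (\<lambda>S. if S = {} then 1 else c (Min S) (Max S))"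
      using c by (intro feasible_if_homogeneous[OF k H s b']) blast+
    with k H have "Suc r \<le> r"
      unfolding r_def by (rule feasible_le_r_star)
    then show False
      by simp
  qed
qed

section \<open>The lower bound\<close>

text \<open>Residues are shifted by one so that the parts of \<open>turan_graph\<close> are named by
  the points \<open>{1..r}\<close> of a feasible colouring.\<close>

definition part_of :: "nat \<Rightarrow> nat \<Rightarrow> nat" where
  "part_of r x = Suc (x mod r)"

lemma part_of_in: "1 \<le> r \<Longrightarrow> part_of r x \<in> {1..r}"
  by (simp add: part_of_def Suc_le_eq)

lemma turan_edge:
  assumes "e \<in> edges (turan_graph n r)"
  obtains x y where "e = {x, y}" "x \<in> {1..n}" "y \<in> {1..n}" "part_of r x \<noteq> part_of r y"
proof -
  obtain x y where "e = {x, y}" "x \<in> {1..n}" "y \<in> {1..n}" "x mod r \<noteq> y mod r"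
    using assms unfolding turan_graph_def by (simp only: snd_conv mem_Collect_eq) blast
  then show thesis
    by (intro that) (simp_all add: part_of_def)
qed

text \<open>An edge maps to a pair if it crosses between parts and to a singleton if it lies inside
  one, so the singletons colour the interiors of the parts.\<close>

lemma blowup_colouring:
  assumes "1 \<le> r" "feasible k H r \<xi>"
  shows "edge_colouring k n (\<lambda>e. \<xi> (part_of r ` e))"
  unfolding edge_colouring_def
proof
  fix e assume "e \<in> edges (complete_graph n)"
  then have "finite e" "card e = 2"
    by (auto simp: complete_graph_def nsets_def)
  then have "part_of r ` e \<subseteq> {1..r}" "card (part_of r ` e) \<le> 2"
    using part_of_in[OF assms(1)] card_image_le[of e "part_of r"] by auto
  then show "\<xi> (part_of r ` e) \<in> {1..k}"
    using assms(2) unfolding feasible_def by blast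
qed

text \<open>The two alternatives of the theorem enter only through \<open>inside\<close>.\<close>

lemma turan_edges_nim:
  assumes r: "1 \<le> r" and \<xi>: "feasible k H r \<xi>"
    and H: "\<And>i. i \<in> {1..k} \<Longrightarrow> fin_simple_graph (H i)"
    and inside: "\<And>i F f e x y. \<lbrakk>i \<in> {1..k}; graph_iso f (H i) F; fin_simple_graph F;
        \<forall>e\<in>edges F. \<xi> (part_of r ` e) = i; e \<in> edges F; {x, y} \<in> edges F;
        e \<in> edges (turan_graph n r)\<rbrakk> \<Longrightarrow> part_of r x \<noteq> part_of r y"
  shows "edges (turan_graph n r) \<subseteq> nim_edges k H n (\<lambda>e. \<xi> (part_of r ` e))"
proof
  fix e assume e: "e \<in> edges (turan_graph n r)"
  then obtain x y where "e = {x, y}" "x \<in> {1..n}" "y \<in> {1..n}" "part_of r x \<noteq> part_of r y"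
    by (rule turan_edge)
  then have "e \<in> edges (complete_graph n)"
    by (auto simp: complete_graph_def)
  moreover have False
    if i: "i \<in> {1..k}" and F: "is_copy_in F (H i) (complete_graph n)" and eF: "e \<in> edges F"
      and mono: "\<forall>e'\<in>edges F. \<xi> (part_of r ` e') = i" for i F
  proof -
    obtain f where f: "graph_iso f (H i) F"
      using F by (auto simp: is_copy_in_def)
    have Fsub: "verts F \<subseteq> {1..n}" "edges F \<subseteq> nsets {1..n} 2"
      using F by (auto simp: is_copy_in_def subgraph_def complete_graph_def)
    have img: "f ` e' \<in> edges F" if "e' \<in> edges (H i)" for e'
      using f that by (auto simp: graph_iso_def)
    have bij: "bij_betw f (verts (H i)) (verts F)"
      using f by (simp add: graph_iso_def)
    \<comment> \<open>Being a subgraph of the complete graph does not confine the edges of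
      \<open>F\<close> to \<open>verts F\<close>; the isomorphism with the simple graph
      \<open>H i\<close> does.\<close>
    have "edges F \<subseteq> nsets (verts F) 2"
    proof
      fix e' assume "e' \<in> edges F"
      then obtain d where d: "d \<in> edges (H i)" "e' = f ` d"
        using f by (auto simp: graph_iso_def)
      obtain u v where "d = {u, v}" "u \<in> verts (H i)" "v \<in> verts (H i)" "u \<noteq> v"
        using edge_doubleton[OF H[OF i] d(1)] .
      then show "e' \<in> nsets (verts F) 2"
        using bij d(2) by (auto simp: bij_betw_def dest: inj_onD)
    qed
    then have simpleF: "fin_simple_graph F"
      using Fsub(1) finite_subset by (auto simp: fin_simple_graph_def)
    have "graph_hom (part_of r \<circ> f) (H i) (colour_graph r \<xi> i)"
      unfolding graph_hom_def
    proof (intro conjI ballI)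
      show "part_of r \<circ> f \<in> verts (H i) \<rightarrow> verts (colour_graph r \<xi> i)"
        using part_of_in[OF r] by (auto simp: colour_graph_def)
    next
      fix d assume d: "d \<in> edges (H i)"
      obtain u v where uv: "d = {u, v}"
        using edge_doubleton[OF H[OF i] d] by metis
      have "{f u, f v} \<in> edges F"
        using img[OF d] by (simp add: uv)
      \<comment> \<open>\<open>inside\<close> makes the projected edge a genuine pair, as edges of
        \<open>colour_graph\<close> must be.\<close>
      then have "part_of r (f u) \<noteq> part_of r (f v)" "\<xi> {part_of r (f u), part_of r (f v)} = i"
        using inside[OF i f simpleF mono eF _ e] mono by fastforce+
      then show "(part_of r \<circ> f) ` d \<in> edges (colour_graph r \<xi> i)"
        using part_of_in[OF r] by (simp add: uv colour_graph_def)
    qed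
    then show False
      using \<xi> i unfolding feasible_def by blast
  qed
  ultimately show "e \<in> nim_edges k H n (\<lambda>e. \<xi> (part_of r ` e))"
    unfolding nim_edges_def by blast
qed

lemma feasible_pair_neq_singleton:
  assumes "1 \<le> r" "feasible k H r \<xi>" "part_of r x \<noteq> part_of r y"
  shows "\<xi> {part_of r x, part_of r y} \<noteq> \<xi> {part_of r x}" "\<xi> {part_of r x, part_of r y} \<noteq> \<xi> {part_of r y}"
proof -
  have P2: "\<xi> {a, b} \<noteq> \<xi> {a}" if "a \<in> {1..r}" "b \<in> {1..r}" "a \<noteq> b" for a b
    using assms(2) that by (simp add: feasible_def)
  show "\<xi> {part_of r x, part_of r y} \<noteq> \<xi> {part_of r x}"
    using assms by (intro P2 part_of_in)
  show "\<xi> {part_of r x, part_of r y} \<noteq> \<xi> {part_of r y}"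
    using assms P2[of "part_of r y" "part_of r x"] part_of_in[OF assms(1)] by (simp add: insert_commute)
qed

lemma turan_number_le_nim:
  assumes "1 \<le> r" "feasible k H r \<xi>"
    and "edges (turan_graph n r) \<subseteq> nim_edges k H n (\<lambda>e. \<xi> (part_of r ` e))"
  shows "turan_number n r \<le> nim k H n"
proof -
  have "finite (nim_edges k H n (\<lambda>e. \<xi> (part_of r ` e)))"
    using finite_complete_graph_edges by (auto simp: nim_edges_def)
  then have "turan_number n r \<le> card (nim_edges k H n (\<lambda>e. \<xi> (part_of r ` e)))"
    unfolding turan_number_def using assms(3) by (rule card_mono)
  also have "\<dots> \<le> nim k H n"
    using assms(1,2) by (intro card_nim_edges_le_nim blowup_colouring)
  finally show ?thesis .
qed

text \<open>(P2) on the crossing edge \<open>e\<close> shows that the colour \<open>i\<close> of the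
  copy differs from \<open>c\<close>. An edge inside a part would have colour \<open>c\<close>, so
  the copy contains none.\<close>

lemma turan_number_le_nim_constant_singletons:
  assumes r: "1 \<le> r" and \<xi>: "feasible k H r \<xi>" and c: "\<forall>a\<in>{1..r}. \<xi> {a} = c"
    and H: "\<And>i. i \<in> {1..k} \<Longrightarrow> fin_simple_graph (H i)"
  shows "turan_number n r \<le> nim k H n"
proof (intro turan_number_le_nim[OF r \<xi>] turan_edges_nim[OF r \<xi> H])
  fix i F f e x y
  assume mono: "\<forall>e\<in>edges F. \<xi> (part_of r ` e) = i" and e: "e \<in> edges F" and xy: "{x, y} \<in> edges F"
    and T: "e \<in> edges (turan_graph n r)"
  obtain u v where uv: "e = {u, v}" "part_of r u \<noteq> part_of r v"
    using turan_edge[OF T] .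
  have "\<xi> {part_of r u, part_of r v} = i" "\<xi> {part_of r x, part_of r y} = i"
    using mono e xy by (fastforce simp: uv(1))+
  then show "part_of r x \<noteq> part_of r y"
    using feasible_pair_neq_singleton(1)[OF r \<xi> uv(2)] c part_of_in[OF r] by auto
qed

lemma graph_connected_iso:
  assumes "graph_connected G" "graph_iso f G F" "u \<in> verts F" "v \<in> verts F"
  shows "(u, v) \<in> {(x, y). {x, y} \<in> edges F}\<^sup>*"
proof -
  obtain u' v' where u': "u = f u'" "u' \<in> verts G" and v': "v = f v'" "v' \<in> verts G"
  proof -
    have "u \<in> f ` verts G" "v \<in> f ` verts G"
      using assms(2-4) by (simp_all add: graph_iso_def bij_betw_def)
    then show thesis
      by (elim imageE) (rule that)
  qed
  have "(u', v') \<in> {(x, y). {x, y} \<in> edges G}\<^sup>*"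
    using assms(1) u'(2) v'(2) by (simp add: graph_connected_def)
  then have "(f u', f v') \<in> {(x, y). {x, y} \<in> edges F}\<^sup>*"
  proof (induction rule: rtrancl_induct)
    case (step y z)
    have "f ` {y, z} \<in> edges F"
      using step(2) assms(2) unfolding graph_iso_def by blast
    then show ?case
      using step(3) by (auto intro: rtrancl_into_rtrancl)
  qed simp
  then show ?thesis
    by (simp add: u' v')
qed

text \<open>By (P2), walking along edges of colour \<open>i\<close> from a part whose own colour is not \<open>i\<close> never
  enters a part of colour \<open>i\<close>, hence never uses an edge inside a part.\<close>

lemma turan_number_le_nim_connected:
  assumes r: "1 \<le> r" and \<xi>: "feasible k H r \<xi>"
    and H: "\<And>i. i \<in> {1..k} \<Longrightarrow> fin_simple_graph (H i)"
    and conn: "\<And>i. i \<in> {1..k} \<Longrightarrow> graph_connected (H i)"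
  shows "turan_number n r \<le> nim k H n"
proof (intro turan_number_le_nim[OF r \<xi>] turan_edges_nim[OF r \<xi> H])
  fix i F f e x y
  assume i: "i \<in> {1..k}" and f: "graph_iso f (H i) F" and F: "fin_simple_graph F"
    and mono: "\<forall>e\<in>edges F. \<xi> (part_of r ` e) = i" and e: "e \<in> edges F" and xy: "{x, y} \<in> edges F"
    and T: "e \<in> edges (turan_graph n r)"
  obtain u v where uv: "e = {u, v}" "part_of r u \<noteq> part_of r v"
    using turan_edge[OF T] .
  have col: "\<xi> {part_of r a, part_of r b} = i" if "{a, b} \<in> edges F" for a b
    using mono that by fastforce
  have "u \<in> verts F" "x \<in> verts F"
    using F e xy by (auto simp: fin_simple_graph_def nsets_def uv(1))
  then have "(u, x) \<in> {(x, y). {x, y} \<in> edges F}\<^sup>*"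
    by (rule graph_connected_iso[OF conn[OF i] f])
  then have "\<xi> {part_of r x} \<noteq> i"
  proof (induction rule: rtrancl_induct)
    case base
    then show ?case
      using feasible_pair_neq_singleton(1)[OF r \<xi> uv(2)] col e by (simp add: uv(1))
  next
    case (step a b)
    then have "\<xi> {part_of r a, part_of r b} = i"
      by (intro col) simp
    \<comment> \<open>A step within one part changes nothing; a step between parts uses (P2) at the
      new end \<open>b\<close>.\<close>
    then show ?case
      using feasible_pair_neq_singleton(2)[OF r \<xi>, of a b] step.IH by (cases "part_of r a = part_of r b") auto
  qed
  \<comment> \<open>If \<open>x\<close> and \<open>y\<close> shared a part, the edge between them
    would give \<open>{part_of r x}\<close> the colour \<open>i\<close>.\<close>
  then show "part_of r x \<noteq> part_of r y"
    using col[OF xy] by auto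
qed

theorem theorem1p5:
  fixes k :: nat and H :: "nat \<Rightarrow> 'a graph"
  assumes "k \<ge> 1"
    and "\<And>i. i \<in> {1..k} \<Longrightarrow> fin_simple_graph (H i)"
    and "\<And>i. i \<in> {1..k} \<Longrightarrow> \<not> bipartite (H i)"
  shows "(\<forall>\<epsilon>>0. \<exists>n0. \<forall>n\<ge>n0.
            real (nim k H n) \<le> (1 - 1 / real (r_star k H)) * ((real n)\<^sup>2 / 2) + \<epsilon> * (real n)\<^sup>2)
       \<and> ((\<forall>i\<in>{1..k}. graph_connected (H i)) \<or>
           (\<exists>\<xi> c. feasible k H (r_star k H) \<xi> \<and> (\<forall>a\<in>{1..r_star k H}. \<xi> {a} = c))
          \<longrightarrow> (\<forall>n. nim k H n \<ge> turan_number n (r_star k H)))"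
proof (intro conjI allI impI)
  fix \<epsilon> :: real
  assume "0 < \<epsilon>"
  with assms show "\<exists>n0. \<forall>n\<ge>n0.
      real (nim k H n) \<le> (1 - 1 / real (r_star k H)) * ((real n)\<^sup>2 / 2) + \<epsilon> * (real n)\<^sup>2"
    by (rule nim_upper_bound)
next
  fix n
  have r: "1 \<le> r_star k H"
    using assms by (rule r_star_ge_one)
  assume "(\<forall>i\<in>{1..k}. graph_connected (H i)) \<or>
    (\<exists>\<xi> c. feasible k H (r_star k H) \<xi> \<and> (\<forall>a\<in>{1..r_star k H}. \<xi> {a} = c))"
  then show "turan_number n (r_star k H) \<le> nim k H n"
  proof
    assume conn: "\<forall>i\<in>{1..k}. graph_connected (H i)"
    obtain \<xi> where \<xi>: "feasible k H (r_star k H) \<xi>"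
      using feasible_r_star[of k H, OF assms] by blast
    show ?thesis
      using assms(2) conn by (intro turan_number_le_nim_connected[OF r \<xi>]) blast+
  next
    assume "\<exists>\<xi> c. feasible k H (r_star k H) \<xi> \<and> (\<forall>a\<in>{1..r_star k H}. \<xi> {a} = c)"
    then obtain \<xi> c where "feasible k H (r_star k H) \<xi>" "\<forall>a\<in>{1..r_star k H}. \<xi> {a} = c"
      by blast
    from r this assms(2) show ?thesis
      by (rule turan_number_le_nim_constant_singletons)
  qed
qed

end
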